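(* A graph $G$ with no isolated vertex has a bipartite exact-distance square root if and only if the vertex set of $G$ can be partitioned into two parts inducing subgraphs $F$ and $F'$ such that there are no edges of $G$ between $V(F)$ and $V(F')$ and $F'$ is a clique-dual of $F$.
   Context: All graphs are finite and simple. For a graph $H=(V,E)$, its exact-distance square $H^{[\sharp 2]}$ is the graph with vertex set $V$ in which distinct vertices $x,y$ are adjacent if and only if their distance in $H$ is exactly $2$; $H$ is an exact-distance square root of $G$ if $V(H)=V(G)$ and $H^{[\sharp 2]}=G$. For graphs $F$, $F'$ with no isolated vertices, with $v_1,\dots,v_n$ the vertices of $F$, $F'$ is a clique-dual of $F$ if there is a family $Cl_1,\dots,Cl_n$ of cliques of $F'$ (vertex sets inducing complete subgraphs), indexed by the vertices of $F$, such that every edge of $F'$ has both ends in at least one $Cl_i$, and for distinct $i,j$, $v_i\sim v_j$ in $F$ if and only if $Cl_i\cap Cl_j\neq\emptyset$. *)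

theory Defs
  imports "Graph_Theory.Kuratowski" "Graph_Theory.Shortest_Path"
begin

text \<open>
  A finite simple graph is a \<open>pair_graph\<close>: finite vertex set \<open>pverts\<close> and a symmetric
  irreflexive arc relation \<open>parcs\<close> on it; an edge \<open>xy\<close> is the pair of arcs
  \<open>(x, y)\<close>, \<open>(y, x)\<close>.
\<close>

definition no_isolated :: "'a pair_pre_digraph \<Rightarrow> bool" where
  "no_isolated G \<longleftrightarrow> (\<forall>v \<in> pverts G. \<exists>w \<in> pverts G. (v, w) \<in> parcs G)"

text \<open>Distance is the minimal cost of a walk for unit arc weights (\<open>\<infinity>\<close> if no walk exists).\<close>

definition graph_dist :: "'a pair_pre_digraph \<Rightarrow> 'a \<Rightarrow> 'a \<Rightarrow> ereal" where
  "graph_dist H x y = wf_digraph.\<mu> (with_proj H) (\<lambda>_. 1) x y"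

definition exact_distance_square :: "'a pair_pre_digraph \<Rightarrow> 'a pair_pre_digraph" where
  "exact_distance_square H =
    \<lparr> pverts = pverts H,
      parcs = {(x, y). x \<in> pverts H \<and> y \<in> pverts H \<and> x \<noteq> y \<and> graph_dist H x y = 2} \<rparr>"

definition exact_distance_square_root :: "'a pair_pre_digraph \<Rightarrow> 'a pair_pre_digraph \<Rightarrow> bool" where
  "exact_distance_square_root H G \<longleftrightarrow>
    pair_graph H \<and> pverts H = pverts G \<and> exact_distance_square H = G"

definition bipartite :: "'a pair_pre_digraph \<Rightarrow> bool" where
  "bipartite H \<longleftrightarrow>
    (\<exists>A B. pverts H = A \<union> B \<and> A \<inter> B = {} \<and> parcs H \<subseteq> A \<times> B \<union> B \<times> A)"

definition clique :: "'a pair_pre_digraph \<Rightarrow> 'a set \<Rightarrow> bool" where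
  "clique G S \<longleftrightarrow> S \<subseteq> pverts G \<and> complete_digraph (card S) (with_proj G \<restriction> S)"

text \<open>\<open>clique_dual F' F\<close>: the graph \<open>F'\<close> is a clique-dual of \<open>F\<close>.\<close>

definition clique_dual :: "'b pair_pre_digraph \<Rightarrow> 'a pair_pre_digraph \<Rightarrow> bool" where
  "clique_dual F' F \<longleftrightarrow>
    pair_graph F \<and> no_isolated F \<and> pair_graph F' \<and> no_isolated F' \<and>
    (\<exists>Cl :: 'a \<Rightarrow> 'b set.
      (\<forall>v \<in> pverts F. clique F' (Cl v)) \<and>
      (\<forall>(x, y) \<in> parcs F'. \<exists>v \<in> pverts F. x \<in> Cl v \<and> y \<in> Cl v) \<and>
      (\<forall>u \<in> pverts F. \<forall>v \<in> pverts F. u \<noteq> v \<longrightarrow>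
        ((u, v) \<in> parcs F \<longleftrightarrow> Cl u \<inter> Cl v \<noteq> {})))"

end

(*
  In a bipartite graph two distinct vertices are at distance 2 iff they have a common neighbour,
  and then they lie in the same colour class. If H is a bipartite root with classes A and B, the
  neighbourhoods in H of the vertices of A are therefore cliques of G[B] that exhibit G[B] as a
  clique-dual of G[A]. Conversely, given the cliques Cl v of F', joining every vertex v of F to
  all vertices of Cl v yields a bipartite root.
*)
theory Submission
  imports Defs
begin

lemma pair_graphI:
  assumes "finite (pverts G)" "parcs G \<subseteq> pverts G \<times> pverts G"
    and "\<And>x y. (x, y) \<in> parcs G \<Longrightarrow> (y, x) \<in> parcs G"
    and "\<And>x. (x, x) \<notin> parcs G"
  shows "pair_graph G"
proof
  show "finite (parcs G)"
    using assms(1,2) by (meson finite_SigmaI finite_subset)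
  show "symmetric (with_proj G)"
    using assms(3) by (auto simp: symmetric_def intro: symI)
  show "fst e \<in> pverts G" "snd e \<in> pverts G" "fst e \<noteq> snd e" if "e \<in> parcs G" for e
    using assms(2,4) that by (cases e; auto)+
qed (use assms in auto)

text \<open>Well-formedness of the smaller digraph and compatibility of the endpoint maps, both
  demanded by \<open>induced_subgraph\<close>, come for free: the arcs are cut down to pairs of
  vertices of \<open>F\<close>, and the endpoint maps are the two projections on both sides.\<close>

lemma (in pair_graph) induced_subgraph_iff:
  "induced_subgraph (with_proj F) (with_proj G) \<longleftrightarrow>
    pverts F \<subseteq> pverts G \<and> parcs F = parcs G \<inter> pverts F \<times> pverts F"
proof
  assume "induced_subgraph (with_proj F) (with_proj G)"
  then show "pverts F \<subseteq> pverts G \<and> parcs F = parcs G \<inter> pverts F \<times> pverts F"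
    by (auto simp: induced_subgraph_def subgraph_def)
next
  assume F: "pverts F \<subseteq> pverts G \<and> parcs F = parcs G \<inter> pverts F \<times> pverts F"
  then have "wf_digraph (with_proj F)"
    by unfold_locales auto
  moreover have "wf_digraph (with_proj G)" ..
  ultimately show "induced_subgraph (with_proj F) (with_proj G)"
    using F by (auto simp: induced_subgraph_def subgraph_def compatible_def)
qed

lemma (in pair_graph) pair_graph_restrict:
  "S \<subseteq> pverts G \<Longrightarrow> pair_graph \<lparr>pverts = S, parcs = parcs G \<inter> S \<times> S\<rparr>"
  by (rule pair_graphI) (auto intro: arcs_symmetric finite_subset[OF _ pair_finite_verts]
      dest: no_loops')

text \<open>Writing the induced subgraph as a \<open>with_proj\<close> of a pair digraph makes
  \<open>complete_digraph_pair_def\<close> applicable. Since \<open>S\<close> is then finite and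
  there are no loops, only the presence of all arcs between distinct members remains to be
  checked.\<close>

lemma (in pair_graph) clique_iff:
  "clique G S \<longleftrightarrow> S \<subseteq> pverts G \<and> (\<forall>x\<in>S. \<forall>y\<in>S. x \<noteq> y \<longrightarrow> (x, y) \<in> parcs G)"
proof -
  have "with_proj G \<restriction> S = with_proj \<lparr>pverts = S, parcs = parcs G \<inter> S \<times> S\<rparr>"
    by (auto simp: induce_subgraph_def with_proj_def)
  then show ?thesis
    unfolding clique_def
    by (auto simp: complete_digraph_pair_def intro: finite_subset[OF _ pair_finite_verts]
        dest: no_loops')
qed

lemma (in pair_wf_digraph) awalk_cost_unit: "awalk_cost (\<lambda>_. 1) p = real (length p)"
  by (induct p) auto

lemma (in pair_wf_digraph) graph_dist_conv:
  "graph_dist G x y = (INF p\<in>{p. awalk x p y}. ereal (real (length p)))"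
  by (simp add: graph_dist_def \<mu>_def awalk_cost_unit)

text \<open>The distance is an infimum of walk lengths. The empty walk is excluded by
  \<open>x \<noteq> y\<close>, and a walk of length 1 is the arc \<open>(x, y)\<close>, so the
  question is whether a walk with two arcs exists.\<close>

lemma (in pair_wf_digraph) graph_dist_eq_2_iff:
  assumes "x \<noteq> y"
  shows "graph_dist G x y = 2 \<longleftrightarrow>
    (x, y) \<notin> parcs G \<and> (\<exists>z. (x, z) \<in> parcs G \<and> (z, y) \<in> parcs G)"
proof
  assume dist: "graph_dist G x y = 2"
  have no_arc: "(x, y) \<notin> parcs G"
  proof
    assume "(x, y) \<in> parcs G"
    then have "awalk x [(x, y)] y"
      by (auto simp: awalk_def dest: in_arcsD1)
    then have "graph_dist G x y \<le> ereal (real (length [(x, y)]))"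
      unfolding graph_dist_conv by (intro INF_lower) auto
    with dist show False by simp
  qed
  \<comment> \<open>The strict bound 3 yields an actual walk with fewer than 3 arcs, without an
    argument that the infimum is attained.\<close>
  from dist have "graph_dist G x y < 3" by simp
  then obtain p where p: "awalk x p y" "ereal (real (length p)) < 3"
    unfolding graph_dist_conv by (auto simp: INF_less_iff)
  from p(2) have "ereal (real (length p)) < ereal 3" by simp
  then have "length p < 3" by (simp del: numeral_eq_ereal)
  \<comment> \<open>Lengths 0 and 1 contradict \<open>x \<noteq> y\<close> and
    \<open>no_arc\<close>; in the remaining case \<open>z\<close> is the middle vertex of the
    walk.\<close>
  with p(1) assms no_arc
  have "\<exists>z. (x, z) \<in> parcs G \<and> (z, y) \<in> parcs G"
    by (cases p; cases "tl p"; cases "tl (tl p)") (auto simp: awalk_def)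
  with no_arc show "(x, y) \<notin> parcs G \<and> (\<exists>z. (x, z) \<in> parcs G \<and> (z, y) \<in> parcs G)" ..
next
  assume "(x, y) \<notin> parcs G \<and> (\<exists>z. (x, z) \<in> parcs G \<and> (z, y) \<in> parcs G)"
  then obtain z where no_arc: "(x, y) \<notin> parcs G"
    and z: "(x, z) \<in> parcs G" "(z, y) \<in> parcs G" by blast
  then have "awalk x [(x, z), (z, y)] y"
    by (auto simp: awalk_def dest: in_arcsD1)
  then have "graph_dist G x y \<le> ereal (real (length [(x, z), (z, y)]))"
    unfolding graph_dist_conv by (intro INF_lower) auto
  moreover have "2 \<le> graph_dist G x y"
    unfolding graph_dist_conv
  proof (rule INF_greatest)
    fix p assume "p \<in> {p. awalk x p y}"
    with assms no_arc have "2 \<le> length p"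
      by (cases p; cases "tl p") (auto simp: awalk_def)
    then have "ereal 2 \<le> ereal (real (length p))" by (simp del: numeral_eq_ereal)
    then show "2 \<le> ereal (real (length p))" by simp
  qed
  ultimately show "graph_dist G x y = 2" by simp
qed

text \<open>The non-adjacency in \<open>graph_dist_eq_2_iff\<close> is automatic here, because
  vertices with a common neighbour share a colour class and no arc stays inside a class. Symmetry
  turns the second arc around.\<close>

lemma (in pair_graph) exact_distance_square_bipartite:
  assumes "A \<inter> B = {}" "parcs G \<subseteq> A \<times> B \<union> B \<times> A"
  shows "(x, y) \<in> parcs (exact_distance_square G) \<longleftrightarrow>
    x \<noteq> y \<and> (\<exists>z. (x, z) \<in> parcs G \<and> (y, z) \<in> parcs G)"
proof -
  have "(x, y) \<notin> parcs G" if "(x, z) \<in> parcs G" "(y, z) \<in> parcs G" for z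
    using that assms by blast
  moreover have "(z, y) \<in> parcs G \<longleftrightarrow> (y, z) \<in> parcs G" for z
    using arcs_symmetric by blast
  ultimately show ?thesis
    unfolding exact_distance_square_def
    by (auto simp: graph_dist_eq_2_iff simp del: numeral_eq_ereal dest: in_arcsD1)
qed

lemma clique_dual_of_bipartite_root:
  assumes G: "pair_graph G" "no_isolated G"
    and root: "exact_distance_square_root H G"
    and AB: "pverts H = A \<union> B" "A \<inter> B = {}" "parcs H \<subseteq> A \<times> B \<union> B \<times> A"
  defines "F \<equiv> \<lparr>pverts = A, parcs = parcs G \<inter> A \<times> A\<rparr>"
    and "F' \<equiv> \<lparr>pverts = B, parcs = parcs G \<inter> B \<times> B\<rparr>"
  shows "\<forall>x\<in>A. \<forall>y\<in>B. (x, y) \<notin> parcs G" and "clique_dual F' F"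
proof -
  interpret G: pair_graph G by fact
  interpret H: pair_graph H using root by (simp add: exact_distance_square_root_def)
  have V: "pverts G = A \<union> B"
    using root AB(1) by (simp add: exact_distance_square_root_def)
  have arcs: "(x, y) \<in> parcs G \<longleftrightarrow> x \<noteq> y \<and> (\<exists>z. (x, z) \<in> parcs H \<and> (y, z) \<in> parcs H)" for x y
    using root H.exact_distance_square_bipartite[OF AB(2,3)]
    by (simp add: exact_distance_square_root_def)
  \<comment> \<open>A common neighbour would have to lie in \<open>B\<close> because of
    \<open>x\<close> and in \<open>A\<close> because of \<open>y\<close>.\<close>
  show sep: "\<forall>x\<in>A. \<forall>y\<in>B. (x, y) \<notin> parcs G"
    using AB(2,3) by (auto simp: arcs)
  have F: "pair_graph F" "pair_graph F'"
    unfolding F_def F'_def by (rule G.pair_graph_restrict; simp add: V)+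
  interpret F': pair_graph F' by fact
  \<comment> \<open>By \<open>sep\<close> and symmetry, every neighbour in \<open>G\<close> lies on
    the same side as the vertex itself, so it survives the restriction.\<close>
  have "no_isolated F" "no_isolated F'"
    using G(2) sep G.arcs_symmetric unfolding no_isolated_def F_def F'_def V by fastforce+
  moreover define Cl where "Cl v = {x. (v, x) \<in> parcs H}" for v
  \<comment> \<open>Any two members of \<open>Cl v\<close> have \<open>v\<close> itself as a common
    neighbour in \<open>H\<close>.\<close>
  have "clique F' (Cl v)" if "v \<in> pverts F" for v
    unfolding F'.clique_iff
    using that AB(2,3) by (auto simp: Cl_def F_def F'_def arcs intro!: exI[of _ v] H.arcs_symmetric)
  moreover have "\<exists>v\<in>pverts F. x \<in> Cl v \<and> y \<in> Cl v" if "(x, y) \<in> parcs F'" for x y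
  proof -
    from that obtain v where v: "(x, v) \<in> parcs H" "(y, v) \<in> parcs H" and "x \<in> B"
      by (auto simp: F'_def arcs)
    with AB(2,3) have "v \<in> A" by blast
    with v show ?thesis
      by (auto simp: Cl_def F_def dest: H.arcs_symmetric)
  qed
  \<comment> \<open>The members of \<open>Cl u \<inter> Cl v\<close> are exactly the common
    neighbours of \<open>u\<close> and \<open>v\<close> in \<open>H\<close>.\<close>
  moreover have "(u, v) \<in> parcs F \<longleftrightarrow> Cl u \<inter> Cl v \<noteq> {}"
    if "u \<in> pverts F" "v \<in> pverts F" "u \<noteq> v" for u v
    using that by (auto simp: Cl_def F_def arcs)
  ultimately show "clique_dual F' F"
    using F unfolding clique_dual_def by blast
qed

text \<open>In the constructed \<open>H\<close>, common neighbours of two vertices of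
  \<open>F\<close> are common members of their cliques, and common neighbours of two vertices of
  \<open>F'\<close> are indices of cliques containing both. The duality matches these with the edges
  of \<open>F\<close> and \<open>F'\<close>, and \<open>sep\<close> rules out all other edges of
  \<open>G\<close>.\<close>

lemma bipartite_root_of_clique_dual:
  fixes G F F' :: "'a pair_pre_digraph"
  assumes G: "pair_graph G"
    and V: "pverts F \<union> pverts F' = pverts G" "pverts F \<inter> pverts F' = {}"
    and ind: "induced_subgraph (with_proj F) (with_proj G)"
      "induced_subgraph (with_proj F') (with_proj G)"
    and sep: "\<forall>x\<in>pverts F. \<forall>y\<in>pverts F'. (x, y) \<notin> parcs G"
    and dual: "clique_dual F' F"
  shows "\<exists>H. exact_distance_square_root H G \<and> bipartite H"
proof -
  interpret G: pair_graph G by fact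
  interpret F': pair_graph F' using dual by (simp add: clique_dual_def)
  obtain Cl :: "'a \<Rightarrow> 'a set" where "\<forall>v\<in>pverts F. clique F' (Cl v)"
    and cover: "\<forall>(x, y)\<in>parcs F'. \<exists>v\<in>pverts F. x \<in> Cl v \<and> y \<in> Cl v"
    and meet: "\<forall>u\<in>pverts F. \<forall>v\<in>pverts F. u \<noteq> v \<longrightarrow>
      ((u, v) \<in> parcs F \<longleftrightarrow> Cl u \<inter> Cl v \<noteq> {})"
    using dual unfolding clique_dual_def by blast
  then have cl: "Cl v \<subseteq> pverts F'"
    and cl_arc: "\<lbrakk>x \<in> Cl v; y \<in> Cl v; x \<noteq> y\<rbrakk> \<Longrightarrow> (x, y) \<in> parcs F'" if "v \<in> pverts F" for v x y
    using that by (auto simp: F'.clique_iff)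
  have F: "parcs F = parcs G \<inter> pverts F \<times> pverts F"
    "parcs F' = parcs G \<inter> pverts F' \<times> pverts F'"
    using ind by (auto simp: G.induced_subgraph_iff)
  \<comment> \<open>\<open>E\<close> keeps only the arcs directed from \<open>F\<close> to
    \<open>F'\<close>, so the two kinds of common neighbours appear as a shared second or a shared
    first component.\<close>
  define E where "E = Sigma (pverts F) Cl"
  define H where "H = \<lparr>pverts = pverts G, parcs = E \<union> E\<inverse>\<rparr>"
  have E: "E \<subseteq> pverts F \<times> pverts F'"
    using cl by (auto simp: E_def)
  have bip: "parcs H \<subseteq> pverts F \<times> pverts F' \<union> pverts F' \<times> pverts F"
    using E by (auto simp: H_def)
  have "pair_graph H"
  proof (rule pair_graphI)
    show "finite (pverts H)" by (simp add: H_def)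
    show "parcs H \<subseteq> pverts H \<times> pverts H"
      using bip V(1) by (auto simp: H_def)
    show "(x, x) \<notin> parcs H" for x
      using bip V(2) by blast
  qed (auto simp: H_def)
  then interpret H: pair_graph H .
  have "(x, y) \<in> parcs (exact_distance_square H) \<longleftrightarrow> (x, y) \<in> parcs G" for x y
  proof -
    \<comment> \<open>As \<open>sep\<close> speaks of one direction only, the reversed arc is needed
      to exclude arcs from \<open>F'\<close> to \<open>F\<close>.\<close>
    have "(x, y) \<in> parcs G \<longleftrightarrow> (x, y) \<in> parcs F \<or> (x, y) \<in> parcs F'"
    proof
      assume xy: "(x, y) \<in> parcs G"
      moreover from xy have "(y, x) \<in> parcs G" by (rule G.arcs_symmetric)
      moreover from xy have "x \<in> pverts G" "y \<in> pverts G"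
        by (rule G.in_arcsD1, rule G.in_arcsD2)
      ultimately show "(x, y) \<in> parcs F \<or> (x, y) \<in> parcs F'"
        unfolding F using V(1) sep by blast
    qed (use F in auto)
    \<comment> \<open>\<open>meet\<close> covers only distinct vertices of \<open>F\<close>; for all
      other pairs both sides are false.\<close>
    moreover have "(x, y) \<in> parcs F \<longleftrightarrow> x \<noteq> y \<and> (\<exists>z. (x, z) \<in> E \<and> (y, z) \<in> E)"
    proof -
      have "(x, y) \<in> parcs F \<Longrightarrow> x \<in> pverts F \<and> y \<in> pverts F \<and> x \<noteq> y"
        using F(1) by (auto dest: G.no_loops')
      then show ?thesis
        using meet by (auto simp: E_def)
    qed
    \<comment> \<open>Covering of the edges by cliques gives one direction, completeness of each
      clique the other.\<close>
    moreover have "(x, y) \<in> parcs F' \<longleftrightarrow> x \<noteq> y \<and> (\<exists>z. (z, x) \<in> E \<and> (z, y) \<in> E)"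
      using cover by (auto simp: E_def intro: cl_arc dest: F'.no_loops')
    \<comment> \<open>Using \<open>E\<close> for one arc and its converse for the other would place
      \<open>z\<close> in both \<open>pverts F\<close> and \<open>pverts F'\<close>, which are
      disjoint.\<close>
    moreover have "(\<exists>z. (x, z) \<in> parcs H \<and> (y, z) \<in> parcs H) \<longleftrightarrow>
        (\<exists>z. (x, z) \<in> E \<and> (y, z) \<in> E) \<or> (\<exists>z. (z, x) \<in> E \<and> (z, y) \<in> E)"
      using E V(2) unfolding H_def by auto
    ultimately show ?thesis
      using H.exact_distance_square_bipartite[OF V(2) bip] by blast
  qed
  moreover have "pverts (exact_distance_square H) = pverts G"
    by (simp add: exact_distance_square_def H_def)
  ultimately have "exact_distance_square H = G"
    by (intro pair_pre_digraph.equality) auto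
  moreover have "pverts H = pverts G" by (simp add: H_def)
  moreover have "bipartite H"
    using V bip unfolding bipartite_def H_def by auto
  ultimately show ?thesis
    using \<open>pair_graph H\<close> unfolding exact_distance_square_root_def by blast
qed

theorem theorem6:
  fixes G :: "'a pair_pre_digraph"
  assumes "pair_graph G" and "no_isolated G"
  shows "(\<exists>H. exact_distance_square_root H G \<and> bipartite H) \<longleftrightarrow>
    (\<exists>F F' :: 'a pair_pre_digraph.
      pverts F \<union> pverts F' = pverts G \<and> pverts F \<inter> pverts F' = {} \<and>
      induced_subgraph (with_proj F) (with_proj G) \<and>
      induced_subgraph (with_proj F') (with_proj G) \<and>
      (\<forall>x \<in> pverts F. \<forall>y \<in> pverts F'. (x, y) \<notin> parcs G) \<and>
      clique_dual F' F)"
proof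
  interpret G: pair_graph G by fact
  assume "\<exists>H. exact_distance_square_root H G \<and> bipartite H"
  then obtain H A B where root: "exact_distance_square_root H G"
    and AB: "pverts H = A \<union> B" "A \<inter> B = {}" "parcs H \<subseteq> A \<times> B \<union> B \<times> A"
    unfolding bipartite_def by blast
  from root AB(1) have V: "pverts G = A \<union> B"
    by (simp add: exact_distance_square_root_def)
  \<comment> \<open>The witnesses are the subgraphs of \<open>G\<close> induced by the colour
    classes of \<open>H\<close>.\<close>
  show "\<exists>F F' :: 'a pair_pre_digraph.
      pverts F \<union> pverts F' = pverts G \<and> pverts F \<inter> pverts F' = {} \<and>
      induced_subgraph (with_proj F) (with_proj G) \<and>
      induced_subgraph (with_proj F') (with_proj G) \<and>
      (\<forall>x \<in> pverts F. \<forall>y \<in> pverts F'. (x, y) \<notin> parcs G) \<and>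
      clique_dual F' F"
    using clique_dual_of_bipartite_root[OF assms root AB] AB(2) V
    by (intro exI[of _ "\<lparr>pverts = A, parcs = parcs G \<inter> A \<times> A\<rparr>"]
        exI[of _ "\<lparr>pverts = B, parcs = parcs G \<inter> B \<times> B\<rparr>"])
      (simp add: G.induced_subgraph_iff)
next
  assume "\<exists>F F' :: 'a pair_pre_digraph.
      pverts F \<union> pverts F' = pverts G \<and> pverts F \<inter> pverts F' = {} \<and>
      induced_subgraph (with_proj F) (with_proj G) \<and>
      induced_subgraph (with_proj F') (with_proj G) \<and>
      (\<forall>x \<in> pverts F. \<forall>y \<in> pverts F'. (x, y) \<notin> parcs G) \<and>
      clique_dual F' F"
  then show "\<exists>H. exact_distance_square_root H G \<and> bipartite H"
    using bipartite_root_of_clique_dual[OF assms(1)] by blast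
qed

end
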